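(* Let $\ell_1,\dots,\ell_n:\mathbb{R}^d\to\mathbb{R}$ and $f=\frac1n\sum_{i=1}^n\ell_i$ satisfy Assumptions A and B of the context, and suppose that the problem has full minimizer coherence, i.e. $\sup_{\theta\in\Theta^*}\ell_i(\theta)=\ell_i^*$ for all $i=1,\dots,n$. Let $\{\theta_k\}_{k\ge0}$ be generated by SGD with random reshuffle with step size $\eta=\frac1L$ from an arbitrary $\theta_0\in\mathbb{R}^d$. Then (for every realization of the permutations) for all epochs $B=1,2,\dots$, $$\mathrm{dist}_{\Theta^*}^2(\theta_{nB})\le \prod_{i=1}^n\Big(1-\frac{\mu_i}{L}\Big)^B\,\mathrm{dist}_{\Theta^*}^2(\theta_0).$$
   Context: Problem: minimize $f(\theta)=\frac1n\sum_{i=1}^n \ell_i(\theta)$ over $\theta\in\mathbb{R}^d$, where each $\ell_i:\mathbb{R}^d\to\mathbb{R}$ is differentiable. Assumption A (existence): each $\ell_i$ attains its global minimum $\ell_i^*>-\infty$, with nonempty set of global minimizers $\Theta_i^*\subset\mathbb{R}^d$; $f$ attains its global minimum $f^*>-\infty$, with nonempty set of global minimizers $\Theta^*\subset\mathbb{R}^d$. Assumption B: there are constants $L>0$ and $0<\mu_i\le L$ ($i=1,\dots,n$) such that for every $i$: (1) ($L$-smoothness) $\ell_i(x)\le \ell_i(y)+\langle x-y,\nabla\ell_i(y)\rangle+\frac L2\|x-y\|^2$ for all $x,y\in\mathbb{R}^d$; (2) ($\mu_i$-weak strong convexity) $\ell_i(\omega)\ge \ell_i(x)+\langle\omega-x,\nabla\ell_i(x)\rangle+\frac{\mu_i}{2}\|x-\omega\|^2$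 for all $x\in\mathbb{R}^d$ and all $\omega\in\mathrm{proj}_{\Theta_i^*}(x)\cup\mathrm{proj}_{\Theta^*}(x)$, where $\mathrm{proj}_A(x)$ is the set of Euclidean projections (nearest points) of $x$ onto $A$. SGD: $\theta_{k+1}=\theta_k-\eta\nabla\ell_{\xi(k)}(\theta_k)$, $k=0,1,\dots$. Random reshuffle: at the start of each epoch (block of $n$ consecutive iterations $nB,\dots,n(B+1)-1$, $B=0,1,\dots$) a random permutation of $\{1,\dots,n\}$ is drawn, and $(\xi(nB),\dots,\xi(n(B+1)-1))$ is that permutation; so each index is used exactly once per epoch. Distance: $\mathrm{dist}_A(\theta)=\inf_{u\in A}\|\theta-u\|$. *)

theory Defs
  imports "HOL-Analysis.Analysis"
begin

text \<open>The component functions are indexed by \<open>1, \<dots>, n\<close>; the value of \<open>l i\<close> for other \<open>i\<close> is irrelevant.\<close>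

definition avg_loss :: "nat \<Rightarrow> (nat \<Rightarrow> 'a \<Rightarrow> real) \<Rightarrow> 'a \<Rightarrow> real" where
  "avg_loss n l x = (1 / real n) * (\<Sum>i=1..n. l i x)"

definition argmin_set :: "('a \<Rightarrow> real) \<Rightarrow> 'a set" where
  "argmin_set g = {x. \<forall>y. g x \<le> g y}"

text \<open>Only meaningful for \<open>g\<close> bounded below, in particular when \<open>argmin_set g\<close> is nonempty.\<close>

definition min_value :: "('a \<Rightarrow> real) \<Rightarrow> real" where
  "min_value g = (INF x. g x)"

lemma min_value_eq: "x \<in> argmin_set g \<Longrightarrow> min_value g = g x"
  unfolding min_value_def argmin_set_def
  by (intro cInf_eq_minimum) auto

definition gradient :: "('a::real_inner \<Rightarrow> real) \<Rightarrow> 'a \<Rightarrow> 'a" where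
  "gradient g x = (THE D. GDERIV g x :> D)"

lemma gradient_eqI:
  assumes "GDERIV g x :> D"
  shows "gradient g x = D"
  unfolding gradient_def
proof (rule the_equality)
  show "GDERIV g x :> D" by (fact assms)
next
  fix E assume "GDERIV g x :> E"
  with assms have "(\<lambda>h. h \<bullet> E) = (\<lambda>h. h \<bullet> D)"
    unfolding gderiv_def by (intro has_derivative_unique[of g _ x])
  then have "\<forall>h. h \<bullet> E = h \<bullet> D" by (simp add: fun_eq_iff)
  then show "E = D" by (rule vector_eq_ldot[THEN iffD1])
qed

text \<open>The set of all nearest points; unlike \<open>closest_point\<close>, no choice is made.\<close>

definition proj_set :: "'a::metric_space set \<Rightarrow> 'a \<Rightarrow> 'a set" where
  "proj_set A x = {u \<in> A. \<forall>v\<in>A. dist x u \<le> dist x v}"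

text \<open>Smoothness in the sense of the quadratic upper bound only.\<close>

definition smooth_upper :: "real \<Rightarrow> ('a::real_inner \<Rightarrow> real) \<Rightarrow> bool" where
  "smooth_upper L g \<longleftrightarrow>
     (\<forall>x y. g x \<le> g y + (x - y) \<bullet> gradient g y + L / 2 * (norm (x - y))\<^sup>2)"

text \<open>Strong convexity tested only at the projections of \<open>x\<close> onto the minimizers of \<open>g\<close> itself
  and onto the set \<open>S\<close>, which will be the set of minimizers of the average loss.\<close>

definition weakly_strongly_convex ::
    "real \<Rightarrow> 'a::real_inner set \<Rightarrow> ('a \<Rightarrow> real) \<Rightarrow> bool" where
  "weakly_strongly_convex \<mu> S g \<longleftrightarrow>
     (\<forall>x. \<forall>w \<in> proj_set (argmin_set g) x \<union> proj_set S x.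
        g w \<ge> g x + (w - x) \<bullet> gradient g x + \<mu> / 2 * (norm (x - w))\<^sup>2)"

definition minimizers_exist :: "nat \<Rightarrow> (nat \<Rightarrow> 'a \<Rightarrow> real) \<Rightarrow> bool" where
  "minimizers_exist n l \<longleftrightarrow>
     (\<forall>i\<in>{1..n}. argmin_set (l i) \<noteq> {}) \<and> argmin_set (avg_loss n l) \<noteq> {}"

definition smooth_wsc_losses ::
    "nat \<Rightarrow> (nat \<Rightarrow> 'a::real_inner \<Rightarrow> real) \<Rightarrow> real \<Rightarrow> (nat \<Rightarrow> real) \<Rightarrow> bool" where
  "smooth_wsc_losses n l L \<mu> \<longleftrightarrow>
     L > 0 \<and>
     (\<forall>i\<in>{1..n}. 0 < \<mu> i \<and> \<mu> i \<le> L \<and> smooth_upper L (l i) \<and>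
        weakly_strongly_convex (\<mu> i) (argmin_set (avg_loss n l)) (l i))"

text \<open>The supremum is taken in the extended reals, since a priori \<open>l i\<close> need not be bounded
  above on the set of minimizers of the average loss.\<close>

definition full_minimizer_coherence :: "nat \<Rightarrow> (nat \<Rightarrow> 'a \<Rightarrow> real) \<Rightarrow> bool" where
  "full_minimizer_coherence n l \<longleftrightarrow>
     (\<forall>i\<in>{1..n}. (SUP x \<in> argmin_set (avg_loss n l). ereal (l i x)) = ereal (min_value (l i)))"

text \<open>The realizations of the random index sequence that random reshuffling can produce:
  on every epoch it enumerates each of the indices \<open>1, \<dots>, n\<close> exactly once.\<close>

definition reshuffle_sequence :: "nat \<Rightarrow> (nat \<Rightarrow> nat) \<Rightarrow> bool" where
  "reshuffle_sequence n \<xi> \<longleftrightarrow> (\<forall>B. bij_betw \<xi> {n * B..<n * (B + 1)} {1..n})"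

definition sgd_iterates ::
    "(nat \<Rightarrow> 'a::real_inner \<Rightarrow> real) \<Rightarrow> real \<Rightarrow> (nat \<Rightarrow> nat) \<Rightarrow> (nat \<Rightarrow> 'a) \<Rightarrow> bool" where
  "sgd_iterates l \<eta> \<xi> \<theta> \<longleftrightarrow>
     (\<forall>k. \<theta> (Suc k) = \<theta> k - \<eta> *\<^sub>R gradient (l (\<xi> k)) (\<theta> k))"

end

theory Submission
  imports Defs
begin

text \<open>Coherence forces every minimizer of the average loss to minimize every single component. Hence,
  if \<open>w\<close> is a nearest point of \<open>\<Theta>\<^sup>*\<close> to the current iterate \<open>x\<close>, it is a minimizer of the component
  \<open>g\<close> used in this step and at the same time a point at which weak strong convexity of \<open>g\<close> may be
  tested. The descent lemma bounds the squared gradient norm by \<open>2 L (g x - g w)\<close>, and with step size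
  \<open>1 / L\<close> this cancels exactly against the function gap in the convexity inequality. What remains is
  a contraction of the squared distance to \<open>w\<close> by \<open>1 - \<mu> / L\<close>
  (\<open>gradient_step_contracts_towards_minimizer\<close>), and so of the squared distance to \<open>\<Theta>\<^sup>*\<close>.

  The same set \<open>\<Theta>\<^sup>*\<close> serves for all components, so the contraction factors multiply along the
  trajectory. As each epoch uses every component once, in whatever order, every epoch contributes the
  same product of factors (\<open>prod_reshuffle_sequence\<close>).\<close>

lemma closed_argmin_set:
  fixes g :: "'a::topological_space \<Rightarrow> real"
  assumes "continuous_on UNIV g"
  shows "closed (argmin_set g)"
  unfolding argmin_set_def
  by (intro closed_Collect_all closed_Collect_le continuous_intros assms)

lemma proj_set_nonempty:
  fixes A :: "'a::heine_borel set"
  assumes "closed A" "A \<noteq> {}"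
  obtains w where "w \<in> proj_set A x"
proof (rule distance_attains_inf[OF assms, of x])
  fix w assume "w \<in> A" "\<And>v. v \<in> A \<Longrightarrow> dist x w \<le> dist x v"
  then show thesis by (intro that[of w]) (simp add: proj_set_def)
qed

lemma infdist_eq_dist_proj_set:
  assumes "w \<in> proj_set A x"
  shows "infdist x A = dist x w"
proof (rule antisym)
  show "infdist x A \<le> dist x w"
    using assms by (intro infdist_le) (auto simp: proj_set_def)
  show "dist x w \<le> infdist x A"
    using assms by (auto simp: infdist_def proj_set_def intro!: cINF_greatest)
qed

lemma argmin_avg_loss_subset_argmin:
  assumes "full_minimizer_coherence n l" "i \<in> {1..n}" "argmin_set (l i) \<noteq> {}"
  shows "argmin_set (avg_loss n l) \<subseteq> argmin_set (l i)"
proof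
  fix u assume u: "u \<in> argmin_set (avg_loss n l)"
  obtain v where v: "v \<in> argmin_set (l i)" using assms(3) by blast
  have "ereal (l i u) \<le> (SUP x \<in> argmin_set (avg_loss n l). ereal (l i x))"
    using u by (rule SUP_upper)
  also have "\<dots> = ereal (l i v)"
    using assms(1,2) min_value_eq[OF v] by (simp add: full_minimizer_coherence_def)
  finally have "l i u \<le> l i v" by simp
  with v show "u \<in> argmin_set (l i)"
    by (auto simp: argmin_set_def intro: order_trans[of _ "l i v"])
qed

text \<open>A gradient step of length \<open>1 / L\<close> decreases \<open>g\<close> by at least half the squared gradient norm over
  \<open>L\<close>, and it cannot get below the minimum.\<close>

lemma norm_gradient_le_gap:
  assumes "L > 0" "smooth_upper L g" "w \<in> argmin_set g"
  shows "(norm (gradient g x))\<^sup>2 \<le> 2 * L * (g x - g w)"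
proof -
  let ?G = "gradient g x" and ?y = "x - (1 / L) *\<^sub>R gradient g x"
  have "g w \<le> g ?y" using assms(3) by (simp add: argmin_set_def)
  also have "\<dots> \<le> g x + (?y - x) \<bullet> ?G + L / 2 * (norm (?y - x))\<^sup>2"
    using assms(2) unfolding smooth_upper_def by blast
  also have "\<dots> = g x - (norm ?G)\<^sup>2 / (2 * L)"
    using assms(1) by (simp add: power2_eq_square[of L] field_simps flip: power2_norm_eq_inner)
  finally show ?thesis using assms(1) by (simp add: field_simps)
qed

lemma gradient_step_contracts_towards_minimizer:
  assumes "L > 0" "smooth_upper L g" "weakly_strongly_convex \<mu> S g"
    and "w \<in> argmin_set g" "w \<in> proj_set S x"
  shows "(dist (x - (1 / L) *\<^sub>R gradient g x) w)\<^sup>2 \<le> (1 - \<mu> / L) * (dist x w)\<^sup>2"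
proof -
  let ?G = "gradient g x"
  have "g w \<ge> g x + (w - x) \<bullet> ?G + \<mu> / 2 * (norm (x - w))\<^sup>2"
    using assms(3,5) unfolding weakly_strongly_convex_def by blast
  then have conv: "g x - g w + \<mu> / 2 * (dist x w)\<^sup>2 \<le> (x - w) \<bullet> ?G"
    by (simp add: inner_diff_left dist_norm)
  have "(dist (x - (1 / L) *\<^sub>R ?G) w)\<^sup>2 = (norm ((x - w) - (1 / L) *\<^sub>R ?G))\<^sup>2"
    by (simp add: dist_norm algebra_simps)
  also have "\<dots> = (norm (x - w))\<^sup>2 - 2 * ((x - w) \<bullet> ((1 / L) *\<^sub>R ?G)) + (norm ((1 / L) *\<^sub>R ?G))\<^sup>2"
    using dot_norm_neg[of "x - w" "(1 / L) *\<^sub>R ?G"] by argo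
  also have "\<dots> = (dist x w)\<^sup>2 - (2 / L) * ((x - w) \<bullet> ?G) + (1 / L\<^sup>2) * (norm ?G)\<^sup>2"
    by (simp add: dist_norm power_divide)
  also have "\<dots> \<le> (dist x w)\<^sup>2 - (2 / L) * (g x - g w + \<mu> / 2 * (dist x w)\<^sup>2)
      + (1 / L\<^sup>2) * (2 * L * (g x - g w))"
    using assms(1) conv norm_gradient_le_gap[OF assms(1,2,4), of x]
    by (intro add_mono diff_mono mult_left_mono) auto
  also have "\<dots> = (1 - \<mu> / L) * (dist x w)\<^sup>2"
    using assms(1) by (simp add: field_simps power2_eq_square)
  finally show ?thesis .
qed

lemma gradient_step_contracts_infdist:
  fixes S :: "'a::{real_inner, heine_borel} set"
  assumes "L > 0" "smooth_upper L g" "weakly_strongly_convex \<mu> S g"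
    and "closed S" "S \<noteq> {}" "S \<subseteq> argmin_set g"
  shows "(infdist (x - (1 / L) *\<^sub>R gradient g x) S)\<^sup>2 \<le> (1 - \<mu> / L) * (infdist x S)\<^sup>2"
proof -
  obtain w where w: "w \<in> proj_set S x" using proj_set_nonempty[OF assms(4,5)] .
  then have "w \<in> S" by (simp add: proj_set_def)
  then have "(infdist (x - (1 / L) *\<^sub>R gradient g x) S)\<^sup>2 \<le> (dist (x - (1 / L) *\<^sub>R gradient g x) w)\<^sup>2"
    by (intro power_mono infdist_le infdist_nonneg)
  also have "\<dots> \<le> (1 - \<mu> / L) * (dist x w)\<^sup>2"
    using assms(6) w \<open>w \<in> S\<close> by (intro gradient_step_contracts_towards_minimizer[OF assms(1-3)]) auto
  finally show ?thesis using infdist_eq_dist_proj_set[OF w] by simp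
qed

lemma reshuffle_sequence_range:
  assumes "reshuffle_sequence n \<xi>" "n \<ge> 1"
  shows "\<xi> k \<in> {1..n}"
proof -
  have "k \<in> {n * (k div n)..<n * (k div n + 1)}"
    using assms(2) dividend_less_times_div[of n k] times_div_less_eq_dividend[of n k] by auto
  moreover have "bij_betw \<xi> {n * (k div n)..<n * (k div n + 1)} {1..n}"
    using assms(1) unfolding reshuffle_sequence_def by (rule spec)
  ultimately show ?thesis by (rule bij_betw_apply[rotated])
qed

lemma prod_reshuffle_sequence:
  fixes c :: "nat \<Rightarrow> 'a::comm_monoid_mult"
  assumes "reshuffle_sequence n \<xi>"
  shows "(\<Prod>k<n * B. c (\<xi> k)) = (\<Prod>i=1..n. c i) ^ B"
proof -
  have "(\<Prod>k<n * B. c (\<xi> k)) = (\<Prod>b<B. \<Prod>k=n * b..<n * (b + 1). c (\<xi> k))"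
    using prod.nat_group[of "\<lambda>k. c (\<xi> k)" n B] by (simp add: mult.commute[of n] add.commute[of n])
  also have "\<dots> = (\<Prod>b<B. \<Prod>i=1..n. c i)"
    using assms unfolding reshuffle_sequence_def
    by (intro prod.cong refl prod.reindex_bij_betw) auto
  finally show ?thesis by simp
qed

lemma prod_bound_of_contraction_steps:
  fixes d c :: "nat \<Rightarrow> real"
  assumes "\<And>k. d (Suc k) \<le> c k * d k" "\<And>k. c k \<ge> 0"
  shows "d m \<le> (\<Prod>k<m. c k) * d 0"
proof (induction m)
  case (Suc m)
  have "d (Suc m) \<le> c m * d m" by (rule assms)
  also have "\<dots> \<le> c m * ((\<Prod>k<m. c k) * d 0)"
    using Suc assms(2) by (intro mult_left_mono)
  finally show ?case by (simp add: mult_ac)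
qed simp

theorem theorem2:
  fixes n :: nat
    and l :: "nat \<Rightarrow> real ^ 'd \<Rightarrow> real"
    and L :: real and \<mu> :: "nat \<Rightarrow> real"
    and \<xi> :: "nat \<Rightarrow> nat"
    and \<theta> :: "nat \<Rightarrow> real ^ 'd"
  assumes "n \<ge> 1"
    and "\<forall>i\<in>{1..n}. \<forall>x. (l i) differentiable (at x)"
    and "minimizers_exist n l"
    and "smooth_wsc_losses n l L \<mu>"
    and "full_minimizer_coherence n l"
    and "reshuffle_sequence n \<xi>"
    and "sgd_iterates l (1 / L) \<xi> \<theta>"
  shows "\<forall>B\<ge>1. (infdist (\<theta> (n * B)) (argmin_set (avg_loss n l)))\<^sup>2
           \<le> (\<Prod>i=1..n. (1 - \<mu> i / L) ^ B) * (infdist (\<theta> 0) (argmin_set (avg_loss n l)))\<^sup>2"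
proof (intro allI impI)
  fix B :: nat
  define S where "S = argmin_set (avg_loss n l)"
  have range: "\<xi> k \<in> {1..n}" for k
    using assms(6,1) by (rule reshuffle_sequence_range)
  have L: "L > 0" using assms(4) by (simp add: smooth_wsc_losses_def)
  have S: "closed S" "S \<noteq> {}"
  proof -
    have "continuous_on UNIV (l i)" if "i \<in> {1..n}" for i
      using assms(2) that
      by (intro differentiable_imp_continuous_on) (simp add: differentiable_on_def)
    then have "continuous_on UNIV (avg_loss n l)"
      unfolding avg_loss_def by (intro continuous_intros) auto
    then show "closed S" unfolding S_def by (rule closed_argmin_set)
    show "S \<noteq> {}" using assms(3) by (simp add: S_def minimizers_exist_def)
  qed
  have step: "(infdist (\<theta> (Suc k)) S)\<^sup>2 \<le> (1 - \<mu> (\<xi> k) / L) * (infdist (\<theta> k) S)\<^sup>2" for k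
  proof -
    have "S \<subseteq> argmin_set (l (\<xi> k))"
      using assms(3) range[of k] unfolding S_def minimizers_exist_def
      by (intro argmin_avg_loss_subset_argmin[OF assms(5)]) auto
    moreover have "smooth_upper L (l (\<xi> k))" "weakly_strongly_convex (\<mu> (\<xi> k)) S (l (\<xi> k))"
      using assms(4) range[of k] unfolding S_def smooth_wsc_losses_def by blast+
    moreover have "\<theta> (Suc k) = \<theta> k - (1 / L) *\<^sub>R gradient (l (\<xi> k)) (\<theta> k)"
      using assms(7) unfolding sgd_iterates_def by blast
    ultimately show ?thesis
      using gradient_step_contracts_infdist[OF L _ _ S] by metis
  qed
  have "1 - \<mu> (\<xi> k) / L \<ge> 0" for k
    using assms(4) range[of k] L by (auto simp: smooth_wsc_losses_def)
  with step have "(infdist (\<theta> (n * B)) S)\<^sup>2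
      \<le> (\<Prod>k<n * B. 1 - \<mu> (\<xi> k) / L) * (infdist (\<theta> 0) S)\<^sup>2"
    by (rule prod_bound_of_contraction_steps)
  also have "(\<Prod>k<n * B. 1 - \<mu> (\<xi> k) / L) = (\<Prod>i=1..n. (1 - \<mu> i / L) ^ B)"
    using prod_reshuffle_sequence[OF assms(6), of "\<lambda>i. 1 - \<mu> i / L"]
    by (simp add: prod_power_distrib)
  finally show "(infdist (\<theta> (n * B)) (argmin_set (avg_loss n l)))\<^sup>2
      \<le> (\<Prod>i=1..n. (1 - \<mu> i / L) ^ B) * (infdist (\<theta> 0) (argmin_set (avg_loss n l)))\<^sup>2"
    unfolding S_def .
qed

end
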